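(* Let $\mathcal F=\{\langle\cdot,\cdot\rangle_i\}_{i\in I\cup\{0\}}$ be a family of inner products on a vector space $V$ over a field $\mathbb{K}$ such that $\mathfrak r_0:=\mathrm{rad}(\langle\cdot,\cdot\rangle_0)\subseteq\mathrm{rad}(\langle\cdot,\cdot\rangle_i)$ for every $i\in I$ and each $\langle\cdot,\cdot\rangle_i$ is partially continuous relative to the $\langle\cdot,\cdot\rangle_0$-topology of $V$. Suppose $\mathcal F$ is simultaneously orthogonalizable, and let $\{T_i\}_{i\in I\cup\{0\}}$ be a simultaneously diagonalizable collection of $\langle\cdot,\cdot\rangle_0$-self-adjoint continuous linear maps $T_i\colon V\to V$ with $T_i(\mathfrak r_0)=0$ and $\langle x,y\rangle_i=\langle T_i(x),y\rangle_0$ for all $x,y\in V$ and all $i$ (such a collection exists because $\mathcal F$ is simultaneously orthogonalizable). Then $V$ is the direct sum of the root spaces $V_\alpha$, where $\alpha$ ranges over the roots of $\{T_i\}$, and this sum is orthogonal relative to every inner product of $\mathcal F$. Moreover, for any $i$ and $\alpha$ we have $\langle\cdot,\cdot\rangle_i|_{V_\alpha}=c_{i,\alpha}\langle\cdot,\cdot\rangle_0|_{V_\alpha}$ for suitable $c_{i,\alpha}\in\mathbb{K}$, and each $\langle\cdot,\cdot\rangle_i$ can be represented in block diagonal form, where each block is the matrix of $c_{i,\alpha}\langle\cdot,\cdot\rangle_0|_{V_\alpha}$ relative to some basis of $V_\alpha$.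
   Context: An inner product on a $\mathbb{K}$-vector space $V$ is a symmetric bilinear form $\langle\cdot,\cdot\rangle\colon V\times V\to\mathbb{K}$; its radical is $\mathrm{rad}(\langle\cdot,\cdot\rangle)=\{x\in V\colon\langle x,V\rangle=0\}$, and it is nondegenerate if its radical is $0$. For $v\in V$, $v^\perp=\{x\in V\colon\langle x,v\rangle=0\}$. If $\langle\cdot,\cdot\rangle$ is nondegenerate, the $\langle\cdot,\cdot\rangle$-topology of $V$ is the topology in which a basis of neighborhoods of $x\in V$ is given by the sets $x+\bigcap_{k=1}^n v_k^\perp$ with $v_1,\dots,v_n\in V$ a finite collection. If $\langle\cdot,\cdot\rangle$ is arbitrary with radical $\mathfrak r$, then $\langle v+\mathfrak r,w+\mathfrak r\rangle_{\mathfrak r}:=\langle v,w\rangle$ is a nondegenerate inner product on $V/\mathfrak r$, and the $\langle\cdot,\cdot\rangle$-topology of $V$ is the initial topology on $V$ induced by the canonical projection $p\colon V\to V/\mathfrak r$, where $V/\mathfrak r$ has the $\langle\cdot,\cdot\rangle_{\mathfrak r}$-topology. $\mathbb{K}$ carries the discrete topology. A map $B\colon X\times X\to Y$ is partially continuous if $B(x,\_)$ and $B(\_,x)$ are continuous for every $x\in X$. Continuity of $T_i$ is relative to the $\langle\cdot,\cdot\rangle_0$-topology of $V$. A family $\{\langle\cdot,\cdot\rangle_i\}$ is simultaneously orthogonalizable if there is a basis $\{v_j\}$ of $V$ with $\langle v_j,v_k\rangle_i=0$ for all $i$ and all $j\neq k$. A family $\mathcal T\subset\mathrm{End}(V)$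 is simultaneously diagonalizable if there is a basis $B$ of $V$ with $T(v)\in\mathbb{K}v$ for all $v\in B$, $T\in\mathcal T$. A linear map $T$ is $\langle\cdot,\cdot\rangle_0$-self-adjoint if $\langle T(x),y\rangle_0=\langle x,T(y)\rangle_0$ for all $x,y$. A root of $\mathcal T\subset\mathrm{End}(V)$ is a map $\alpha\colon\mathcal T\to\mathbb{K}$ for which there is a nonzero $v\in V$ with $T(v)=\alpha(T)v$ for all $T\in\mathcal T$; its root space is $V_\alpha=\{w\in V\colon T(w)=\alpha(T)w\ \forall T\in\mathcal T\}$. *)

theory Defs
  imports "HOL-Analysis.Analysis" "HOL-Library.Set_Algebras" "HOL-Library.FuncSet"
begin

section \<open>Inner products\<close>

text \<open>The vector space is a whole type \<^typ>\<open>'v\<close> with scalar multiplication \<^term>\<open>smul\<close>.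
  No positivity or nondegeneracy is required of an inner product.\<close>

definition inner_product ::
    "('k::field \<Rightarrow> 'v::ab_group_add \<Rightarrow> 'v) \<Rightarrow> ('v \<Rightarrow> 'v \<Rightarrow> 'k) \<Rightarrow> bool" where
  "inner_product smul b \<longleftrightarrow>
     (\<forall>x. Vector_Spaces.linear smul (*) (\<lambda>y. b x y)) \<and>
     (\<forall>y. Vector_Spaces.linear smul (*) (\<lambda>x. b x y)) \<and>
     (\<forall>x y. b x y = b y x)"

definition form_radical :: "('v \<Rightarrow> 'v \<Rightarrow> 'k::zero) \<Rightarrow> 'v set" where
  "form_radical b = {x. \<forall>y. b x y = 0}"

definition nondegenerate :: "('v::zero \<Rightarrow> 'v \<Rightarrow> 'k::zero) \<Rightarrow> bool" where
  "nondegenerate b \<longleftrightarrow> form_radical b = {0}"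

section \<open>The topology of an inner product\<close>

text \<open>Orthogonal complement of \<^term>\<open>v\<close> within a carrier \<^term>\<open>C\<close>.  The carrier is explicit so that
  the next two definitions also apply to a quotient space, whose points are cosets added
  elementwise as in \<^theory>\<open>HOL-Library.Set_Algebras\<close>.\<close>

definition perp_on :: "'a set \<Rightarrow> ('a \<Rightarrow> 'a \<Rightarrow> 'k::zero) \<Rightarrow> 'a \<Rightarrow> 'a set" where
  "perp_on C b v = {x \<in> C. b x v = 0}"

definition perp_topology :: "'a::plus set \<Rightarrow> ('a \<Rightarrow> 'a \<Rightarrow> 'k::zero) \<Rightarrow> 'a topology" where
  "perp_topology C b = topology (\<lambda>U. U \<subseteq> C \<and>
     (\<forall>x\<in>U. \<exists>F. finite F \<and> F \<subseteq> C \<and> x +o (C \<inter> (\<Inter>v\<in>F. perp_on C b v)) \<subseteq> U))"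

definition quotient_carrier :: "'v::plus set \<Rightarrow> 'v set set" where
  "quotient_carrier R = range (\<lambda>v. v +o R)"

text \<open>Well defined on cosets of the radical; see \<open>quotient_form_coset\<close> below.\<close>

definition quotient_form :: "('v::plus \<Rightarrow> 'v \<Rightarrow> 'k::zero) \<Rightarrow> 'v set \<Rightarrow> 'v set \<Rightarrow> 'k" where
  "quotient_form b X Y =
     (THE c. \<exists>v w. X = v +o form_radical b \<and> Y = w +o form_radical b \<and> c = b v w)"

text \<open>The initial topology along the canonical projection to the quotient by the radical.\<close>

definition form_topology :: "('v::plus \<Rightarrow> 'v \<Rightarrow> 'k::zero) \<Rightarrow> 'v topology" where
  "form_topology b = pullback_topology UNIV (\<lambda>v. v +o form_radical b)
     (perp_topology (quotient_carrier (form_radical b)) (quotient_form b))"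

definition partially_continuous ::
    "'a topology \<Rightarrow> 'b topology \<Rightarrow> ('a \<Rightarrow> 'a \<Rightarrow> 'b) \<Rightarrow> bool" where
  "partially_continuous X Y B \<longleftrightarrow>
     (\<forall>x\<in>topspace X. continuous_map X Y (\<lambda>y. B x y) \<and> continuous_map X Y (\<lambda>y. B y x))"

section \<open>Bases, orthogonalizability and diagonalizability\<close>

definition basis_of ::
    "('k::field \<Rightarrow> 'v::ab_group_add \<Rightarrow> 'v) \<Rightarrow> 'v set \<Rightarrow> 'v set \<Rightarrow> bool" where
  "basis_of smul W S \<longleftrightarrow> \<not> module.dependent smul S \<and> module.span smul S = W"

definition simultaneously_orthogonalizable ::
    "('k::field \<Rightarrow> 'v::ab_group_add \<Rightarrow> 'v) \<Rightarrow> ('v \<Rightarrow> 'v \<Rightarrow> 'k) set \<Rightarrow> bool" where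
  "simultaneously_orthogonalizable smul \<F> \<longleftrightarrow>
     (\<exists>S. basis_of smul UNIV S \<and> (\<forall>b\<in>\<F>. \<forall>v\<in>S. \<forall>w\<in>S. v \<noteq> w \<longrightarrow> b v w = 0))"

definition simultaneously_diagonalizable ::
    "('k::field \<Rightarrow> 'v::ab_group_add \<Rightarrow> 'v) \<Rightarrow> ('v \<Rightarrow> 'v) set \<Rightarrow> bool" where
  "simultaneously_diagonalizable smul \<T> \<longleftrightarrow>
     (\<exists>S. basis_of smul UNIV S \<and> (\<forall>v\<in>S. \<forall>T\<in>\<T>. \<exists>c. T v = smul c v))"

definition self_adjoint :: "('v \<Rightarrow> 'v \<Rightarrow> 'k) \<Rightarrow> ('v \<Rightarrow> 'v) \<Rightarrow> bool" where
  "self_adjoint b T \<longleftrightarrow> (\<forall>x y. b (T x) y = b x (T y))"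

definition representing_operators ::
    "('k::field \<Rightarrow> 'v::ab_group_add \<Rightarrow> 'v) \<Rightarrow> 'i set \<Rightarrow> ('i \<Rightarrow> 'v \<Rightarrow> 'v \<Rightarrow> 'k) \<Rightarrow> ('v \<Rightarrow> 'v \<Rightarrow> 'k) \<Rightarrow>
     ('i \<Rightarrow> 'v \<Rightarrow> 'v) \<Rightarrow> bool" where
  "representing_operators smul J B b0 T \<longleftrightarrow>
     simultaneously_diagonalizable smul (T ` J) \<and>
     (\<forall>i\<in>J. Vector_Spaces.linear smul smul (T i) \<and>
            self_adjoint b0 (T i) \<and>
            continuous_map (form_topology b0) (form_topology b0) (T i) \<and>
            (\<forall>x\<in>form_radical b0. T i x = 0) \<and>
            (\<forall>x y. B i x y = b0 (T i x) y))"

section \<open>Roots and root spaces\<close>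

text \<open>A root is a function on \<^term>\<open>\<T>\<close> only; membership in \<^term>\<open>\<T> \<rightarrow>\<^sub>E UNIV\<close> fixes its values
  outside \<^term>\<open>\<T>\<close>, so that distinct roots differ on \<^term>\<open>\<T>\<close>.\<close>

definition root_space ::
    "('k \<Rightarrow> 'v \<Rightarrow> 'v) \<Rightarrow> ('v \<Rightarrow> 'v) set \<Rightarrow> (('v \<Rightarrow> 'v) \<Rightarrow> 'k) \<Rightarrow> 'v set" where
  "root_space smul \<T> \<alpha> = {w. \<forall>T\<in>\<T>. T w = smul (\<alpha> T) w}"

definition roots ::
    "('k \<Rightarrow> 'v::zero \<Rightarrow> 'v) \<Rightarrow> ('v \<Rightarrow> 'v) set \<Rightarrow> (('v \<Rightarrow> 'v) \<Rightarrow> 'k) set" where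
  "roots smul \<T> =
     {\<alpha> \<in> \<T> \<rightarrow>\<^sub>E UNIV. \<exists>v. v \<noteq> 0 \<and> (\<forall>T\<in>\<T>. T v = smul (\<alpha> T) v)}"

section \<open>Direct sums and block diagonal matrices\<close>

text \<open>The whole space is the internal direct sum of the subspaces \<^term>\<open>W j\<close>, \<^term>\<open>j \<in> A\<close>.\<close>

definition internal_direct_sum ::
    "('k::field \<Rightarrow> 'v::ab_group_add \<Rightarrow> 'v) \<Rightarrow> 'j set \<Rightarrow> ('j \<Rightarrow> 'v set) \<Rightarrow> bool" where
  "internal_direct_sum smul A W \<longleftrightarrow>
     (\<forall>j\<in>A. module.subspace smul (W j)) \<and>
     (\<forall>v. \<exists>!f. (\<forall>j\<in>A. f j \<in> W j) \<and> (\<forall>j. j \<notin> A \<longrightarrow> f j = 0) \<and> finite {j. f j \<noteq> 0} \<and>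
               v = (\<Sum>j | f j \<noteq> 0. f j))"

definition orthogonal_family :: "('v \<Rightarrow> 'v \<Rightarrow> 'k::zero) \<Rightarrow> 'j set \<Rightarrow> ('j \<Rightarrow> 'v set) \<Rightarrow> bool" where
  "orthogonal_family b A W \<longleftrightarrow>
     (\<forall>j\<in>A. \<forall>k\<in>A. j \<noteq> k \<longrightarrow> (\<forall>x\<in>W j. \<forall>y\<in>W k. b x y = 0))"

definition form_matrix :: "('v \<Rightarrow> 'v \<Rightarrow> 'k) \<Rightarrow> ('j \<Rightarrow> 'v) \<Rightarrow> 'j \<Rightarrow> 'j \<Rightarrow> 'k" where
  "form_matrix b e = (\<lambda>j k. b (e j) (e k))"

definition block_diagonal ::
    "('j \<Rightarrow> 'l \<Rightarrow> 'l \<Rightarrow> 'k::zero) \<Rightarrow> 'j \<times> 'l \<Rightarrow> 'j \<times> 'l \<Rightarrow> 'k" where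
  "block_diagonal M = (\<lambda>(\<alpha>, v) (\<beta>, w). if \<alpha> = \<beta> then M \<alpha> v w else 0)"

text \<open>With \<^term>\<open>S \<alpha>\<close> a basis of \<^term>\<open>W \<alpha>\<close>, the elements of the bases \<^term>\<open>S \<alpha>\<close> together form a basis
  of the whole space, indexed injectively by the pairs \<open>(\<alpha>, v)\<close> with \<open>v \<in> S \<alpha>\<close>.  Relative to it,
  the matrix of \<^term>\<open>b\<close> is block diagonal, with the matrix of \<^term>\<open>d \<alpha>\<close> relative to \<^term>\<open>S \<alpha>\<close>
  as the block at \<^term>\<open>\<alpha>\<close>.\<close>

definition block_diagonal_wrt ::
    "('k::field \<Rightarrow> 'v::ab_group_add \<Rightarrow> 'v) \<Rightarrow> ('v \<Rightarrow> 'v \<Rightarrow> 'k) \<Rightarrow> 'j set \<Rightarrow> ('j \<Rightarrow> 'v set) \<Rightarrow>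
     ('j \<Rightarrow> 'v \<Rightarrow> 'v \<Rightarrow> 'k) \<Rightarrow> ('j \<Rightarrow> 'v set) \<Rightarrow> bool" where
  "block_diagonal_wrt smul b A W d S \<longleftrightarrow>
     (\<forall>\<alpha>\<in>A. basis_of smul (W \<alpha>) (S \<alpha>)) \<and>
     inj_on snd (Sigma A S) \<and> basis_of smul UNIV (snd ` Sigma A S) \<and>
     (\<forall>p\<in>Sigma A S. \<forall>q\<in>Sigma A S.
        form_matrix b snd p q = block_diagonal (\<lambda>\<alpha>. form_matrix (d \<alpha>) (\<lambda>v. v)) p q)"

section \<open>Well-definedness of the topology\<close>

lemma inner_product_add:
  assumes "inner_product smul b"
  shows "b (x + y) z = b x z + b y z" "b z (x + y) = b z x + b z y"
  using assms module_hom.add[OF Vector_Spaces.linear.axioms(3)]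
  unfolding inner_product_def by blast+

lemma inner_product_sym:
  assumes "inner_product smul b"
  shows "b x y = b y x"
  using assms unfolding inner_product_def by blast

lemma inner_product_diff:
  assumes "inner_product smul b"
  shows "b (x - y) z = b x z - b y z"
  using inner_product_add(1)[OF assms, of "x - y" y z] by simp

lemma radical_add:
  assumes "inner_product smul b" "x \<in> form_radical b" "y \<in> form_radical b"
  shows "x + y \<in> form_radical b"
  using assms by (simp add: form_radical_def inner_product_add[OF assms(1)])

lemma radical_diff:
  assumes "inner_product smul b" "x \<in> form_radical b" "y \<in> form_radical b"
  shows "x - y \<in> form_radical b"
  using assms by (simp add: form_radical_def inner_product_diff[OF assms(1)])

lemma zero_in_radical:
  assumes "inner_product smul b"
  shows "0 \<in> form_radical b"
  using inner_product_diff[OF assms, of 0 0] by (simp add: form_radical_def)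

lemma coset_eq_iff:
  assumes "inner_product smul b"
  shows "v +o form_radical b = w +o form_radical b \<longleftrightarrow> v - w \<in> form_radical b"
proof
  assume "v +o form_radical b = w +o form_radical b"
  moreover have "v \<in> v +o form_radical b"
    using zero_in_radical[OF assms] by (force simp: elt_set_plus_def)
  ultimately show "v - w \<in> form_radical b"
    by (auto simp: elt_set_plus_def)
next
  assume d: "v - w \<in> form_radical b"
  have "v + r = w + ((v - w) + r)" "w + r = v + (r - (v - w))" for r
    by (simp_all add: algebra_simps)
  then show "v +o form_radical b = w +o form_radical b"
    using radical_add[OF assms d] radical_diff[OF assms _ d]
    unfolding elt_set_plus_def by (intro Collect_eqI) metis
qed

lemma coset_add:
  assumes "inner_product smul b"
  shows "(v +o form_radical b) + (w +o form_radical b) = (v + w) +o form_radical b"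
proof -
  have "form_radical b + form_radical b = form_radical b"
    using radical_add[OF assms] zero_in_radical[OF assms]
    by (force simp: set_plus_def)
  then show ?thesis by (simp add: set_plus_rearrange)
qed

lemma quotient_form_coset:
  assumes "inner_product smul b"
  shows "quotient_form b (v +o form_radical b) (w +o form_radical b) = b v w"
  unfolding quotient_form_def
proof (rule the_equality)
  show "\<exists>v' w'. v +o form_radical b = v' +o form_radical b \<and> w +o form_radical b = w' +o form_radical b \<and>
      b v w = b v' w'"
    by blast
next
  fix c
  assume "\<exists>v' w'. v +o form_radical b = v' +o form_radical b \<and> w +o form_radical b = w' +o form_radical b \<and>
      c = b v' w'"
  then obtain v' w' where "v - v' \<in> form_radical b" "w - w' \<in> form_radical b" and c: "c = b v' w'"
    by (auto simp: coset_eq_iff[OF assms])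
  then have "b v w = b v' w" "b w v' = b w' v'"
    by (simp_all add: form_radical_def inner_product_diff[OF assms])
  then show "c = b v w"
    using c inner_product_sym[OF assms] by metis
qed

lemma openin_perp_topology:
  "openin (perp_topology C b) U \<longleftrightarrow> U \<subseteq> C \<and>
     (\<forall>x\<in>U. \<exists>F. finite F \<and> F \<subseteq> C \<and> x +o (C \<inter> (\<Inter>v\<in>F. perp_on C b v)) \<subseteq> U)"
proof -
  let ?P = "\<lambda>U x F. finite F \<and> F \<subseteq> C \<and> x +o (C \<inter> (\<Inter>v\<in>F. perp_on C b v)) \<subseteq> U"
  let ?L = "\<lambda>U. U \<subseteq> C \<and> (\<forall>x\<in>U. \<exists>F. ?P U x F)"
  have "?L (U \<inter> V)" if U: "?L U" and V: "?L V" for U V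
  proof -
    have "\<exists>F. ?P (U \<inter> V) x F" if x: "x \<in> U \<inter> V" for x
    proof -
      from U x obtain F where "?P U x F" by blast
      moreover from V x obtain G where "?P V x G" by blast
      ultimately have "?P (U \<inter> V) x (F \<union> G)"
        unfolding elt_set_plus_def by blast
      then show ?thesis by blast
    qed
    with U V show ?thesis by blast
  qed
  moreover have "?L (\<Union>\<U>)" if "\<forall>U\<in>\<U>. ?L U" for \<U>
    using that by (meson Sup_le_iff Union_iff Union_upper order_trans)
  ultimately have "istopology ?L"
    unfolding istopology_def by blast
  then show ?thesis
    unfolding perp_topology_def by (simp add: topology_inverse')
qed

lemma openin_form_topology:
  assumes ip: "inner_product smul b"
  shows "openin (form_topology b) U \<longleftrightarrow>
     (\<forall>x\<in>U. \<exists>F. finite F \<and> x +o (\<Inter>v\<in>F. {y. b y v = 0}) \<subseteq> U)"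
proof
  let ?p = "\<lambda>v. v +o form_radical b"
  let ?C = "quotient_carrier (form_radical b)"
  let ?q = "quotient_form b"
  assume "openin (form_topology b) U"
  then obtain O' where O: "openin (perp_topology ?C ?q) O'" and U: "U = ?p -` O'"
    by (auto simp: form_topology_def openin_pullback_topology)
  show "\<forall>x\<in>U. \<exists>F. finite F \<and> x +o (\<Inter>v\<in>F. {y. b y v = 0}) \<subseteq> U"
  proof
    fix x assume "x \<in> U"
    then obtain G where G: "finite G" "G \<subseteq> ?C"
      "?p x +o (?C \<inter> (\<Inter>v\<in>G. perp_on ?C ?q v)) \<subseteq> O'"
      using O U by (auto simp: openin_perp_topology)
    from G(1,2) obtain F where F: "finite F" "G = ?p ` F"
      unfolding quotient_carrier_def by (metis finite_subset_image)
    have "x + y \<in> U" if y: "\<forall>v\<in>F. b y v = 0" for y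
    proof -
      have "?p y \<in> ?C \<inter> (\<Inter>v\<in>G. perp_on ?C ?q v)"
        using y by (auto simp: F quotient_carrier_def perp_on_def quotient_form_coset[OF ip])
      then have "?p x + ?p y \<in> O'"
        using G(3) by (auto simp: elt_set_plus_def[of "?p x"])
      then show ?thesis by (simp add: U coset_add[OF ip])
    qed
    with F(1) show "\<exists>F. finite F \<and> x +o (\<Inter>v\<in>F. {y. b y v = 0}) \<subseteq> U"
      by (auto simp: elt_set_plus_def intro!: exI[of _ F])
  qed
next
  let ?p = "\<lambda>v. v +o form_radical b"
  let ?C = "quotient_carrier (form_radical b)"
  let ?q = "quotient_form b"
  assume *: "\<forall>x\<in>U. \<exists>F. finite F \<and> x +o (\<Inter>v\<in>F. {y. b y v = 0}) \<subseteq> U"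
  have "U = ?p -` (?p ` U)"
  proof -
    have "y \<in> U" if "x \<in> U" "?p y = ?p x" for x y
    proof -
      have "y - x \<in> form_radical b"
        using that(2) by (simp add: coset_eq_iff[OF ip])
      moreover obtain F where "x +o (\<Inter>v\<in>F. {y. b y v = 0}) \<subseteq> U"
        using * \<open>x \<in> U\<close> by blast
      ultimately have "x + (y - x) \<in> U"
        by (force simp: elt_set_plus_def form_radical_def)
      then show ?thesis by simp
    qed
    then show ?thesis by blast
  qed
  moreover have "openin (perp_topology ?C ?q) (?p ` U)"
    unfolding openin_perp_topology
  proof (intro conjI ballI)
    show "?p ` U \<subseteq> ?C" by (auto simp: quotient_carrier_def)
  next
    fix X assume "X \<in> ?p ` U"
    then obtain x where x: "x \<in> U" "X = ?p x" by blast
    obtain F where F: "finite F" "x +o (\<Inter>v\<in>F. {y. b y v = 0}) \<subseteq> U"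
      using * x(1) by blast
    have "X + Y \<in> ?p ` U" if Y: "Y \<in> ?C" "\<forall>v\<in>F. ?q Y (?p v) = 0" for Y
    proof -
      obtain y where y: "Y = ?p y" using Y(1) by (auto simp: quotient_carrier_def)
      have "\<forall>v\<in>F. b y v = 0"
        using Y(2) by (simp add: y quotient_form_coset[OF ip])
      then have "x + y \<in> U"
        using F(2) by (auto simp: elt_set_plus_def)
      then show ?thesis by (auto simp: x y coset_add[OF ip])
    qed
    then have "X +o (?C \<inter> (\<Inter>v\<in>?p ` F. perp_on ?C ?q v)) \<subseteq> ?p ` U"
      by (auto simp: elt_set_plus_def[of X] perp_on_def)
    moreover have "finite (?p ` F)" "?p ` F \<subseteq> ?C"
      using F(1) by (auto simp: quotient_carrier_def)
    ultimately show "\<exists>F. finite F \<and> F \<subseteq> ?C \<and>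
        X +o (?C \<inter> (\<Inter>v\<in>F. perp_on ?C ?q v)) \<subseteq> ?p ` U"
      by blast
  qed
  ultimately show "openin (form_topology b) U"
    unfolding form_topology_def openin_pullback_topology by auto
qed

text \<open>In the nondegenerate case the detour through the quotient changes nothing.\<close>

lemma form_topology_nondegenerate:
  assumes "inner_product smul b" "nondegenerate b"
  shows "form_topology b = perp_topology UNIV b"
  unfolding topology_eq openin_form_topology[OF assms(1)] openin_perp_topology
  by (simp add: perp_on_def)

end

theory Submission
  imports Defs
begin

text \<open>
  A basis that is orthogonal for a form \<open>b0\<close> computes coordinates: for a basis vector \<open>v\<close>, the
  number \<open>b0 x v\<close> is the \<open>v\<close>-coordinate of \<open>x\<close> times \<open>b0 v v\<close>.  Hence the isotropic basis vectors
  lie in the radical of \<open>b0\<close>, so they lie in the larger radical of every other form \<open>b\<close> of the family, and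
  the operator that is diagonal with eigenvalues \<open>b v v / b0 v v\<close> at the anisotropic \<open>v\<close> and \<open>0\<close> at the
  isotropic ones represents \<open>b\<close>.  It is self-adjoint because \<open>b\<close> is symmetric, and self-adjointness
  gives continuity: \<open>T\<close> maps the complement of \<open>T v\<close> into the complement of \<open>v\<close>.
  The operators of the whole family are built on the same basis, so they are simultaneously
  diagonalizable (\<open>representing_operators_exist\<close>).

  Conversely, let any representing operators \<open>T i\<close> be given, with a basis \<open>E\<close> of common
  eigenvectors.  The eigenvalues of \<open>v \<in> E\<close> form a root, so the roots partition \<open>E\<close>.
  Comparing coordinates shows that a root space is spanned by its own part of \<open>E\<close>
  (\<open>root_space_eq_span\<close>), and so the root spaces form a direct sum
  (\<open>internal_direct_sum_of_basis_partition\<close>).  They are orthogonal for \<open>b0\<close>, as eigenspaces of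
  self-adjoint operators for different eigenvalues are (\<open>root_spaces_orthogonal\<close>).
  On the root space of \<open>\<alpha>\<close> the operator \<open>T i\<close> is the scalar \<open>\<alpha> (T i)\<close>, so there
  \<open>B i x y = b0 (T i x) y = \<alpha> (T i) * b0 x y\<close>: the constants are \<open>c i \<alpha> = \<alpha> (T i)\<close>, the orthogonality
  passes to every \<open>B i\<close>, and the parts of \<open>E\<close> are bases giving the block diagonal form
  (\<open>root_space_decomposition\<close>).
\<close>

section \<open>Coordinates relative to a basis\<close>

context vector_space
begin

lemma vector_space_pair_field: "vector_space_pair scale ((*) :: 'a \<Rightarrow> 'a \<Rightarrow> 'a)"
  by unfold_locales (simp_all add: algebra_simps)

lemma linear_form_eqI:
  assumes f: "Vector_Spaces.linear scale (*) f" and g: "Vector_Spaces.linear scale (*) g"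
    and S: "basis_of scale UNIV S" and eq: "\<And>v. v \<in> S \<Longrightarrow> f v = g v"
  shows "f x = g x"
proof -
  interpret vp: vector_space_pair scale "(*) :: 'a \<Rightarrow> 'a \<Rightarrow> 'a"
    by (rule vector_space_pair_field)
  show ?thesis
    by (rule vp.linear_eq_on[OF f g _ eq]) (use S in \<open>auto simp: basis_of_def\<close>)
qed

lemma linear_representation_scaled:
  assumes "basis_of scale UNIV S"
  shows "Vector_Spaces.linear scale (*) (\<lambda>x. representation S x v * c)"
proof -
  interpret vp: vector_space_pair scale "(*) :: 'a \<Rightarrow> 'a \<Rightarrow> 'a"
    by (rule vector_space_pair_field)
  have "Vector_Spaces.linear scale (*) (\<lambda>x. representation S x v)"
    using assms by (auto simp: basis_of_def intro!: linear_representation)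
  from vp.linear_compose_scale_right[OF this, of c] show ?thesis
    by (simp add: mult.commute)
qed

lemma eq_0_if_coefficients_eq_0:
  assumes S: "basis_of scale UNIV S" and "\<And>v. v \<in> S \<Longrightarrow> representation S x v = 0"
  shows "x = 0"
proof -
  have "(\<Sum>v | representation S x v \<noteq> 0. scale (representation S x v) v) = x"
    using S by (intro sum_nonzero_representation_eq) (auto simp: basis_of_def)
  moreover have "{v. representation S x v \<noteq> 0} = {}"
    using assms(2) representation_ne_zero by blast
  ultimately show ?thesis by simp
qed

text \<open>Both sides are linear in \<open>x\<close>, so it suffices to compare them on the basis.\<close>

lemma representation_diagonal:
  assumes S: "basis_of scale UNIV S" and T: "Vector_Spaces.linear scale scale T"
    and eig: "\<And>v. v \<in> S \<Longrightarrow> T v = scale (c v) v" and v: "v \<in> S"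
  shows "representation S (T x) v = c v * representation S x v"
proof -
  have S': "independent S" "span S = UNIV"
    using S by (auto simp: basis_of_def)
  have "representation S (T x) v = representation S x v * c v"
  proof (rule linear_form_eqI[OF _ linear_representation_scaled[OF S] S])
    show "Vector_Spaces.linear scale (*) (\<lambda>x. representation S (T x) v)"
      using Vector_Spaces.linear_compose[OF T linear_representation[OF S', of v]]
      by (simp add: o_def)
  next
    fix u assume u: "u \<in> S"
    show "representation S (T u) v = representation S u v * c v"
      using u by (simp add: eig[OF u] representation_scale S' representation_basis)
  qed
  then show ?thesis by (simp add: mult.commute)
qed

text \<open>In particular an isotropic \<open>v\<close> of an orthogonal basis lies in the radical, and the coordinates
  of a vector of the radical vanish at every anisotropic \<open>v\<close>.\<close>

lemma orthogonal_basis_coefficient: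
  assumes b: "inner_product scale b" and S: "basis_of scale UNIV S"
    and orth: "\<And>u. u \<in> S \<Longrightarrow> u \<noteq> v \<Longrightarrow> b u v = 0" and v: "v \<in> S"
  shows "b x v = representation S x v * b v v"
proof (rule linear_form_eqI[OF _ linear_representation_scaled[OF S] S])
  show "Vector_Spaces.linear scale (*) (\<lambda>x. b x v)"
    using b by (simp add: inner_product_def)
next
  fix u assume u: "u \<in> S"
  show "b u v = representation S u v * b v v"
    using S u orth[OF u] by (auto simp: basis_of_def representation_basis)
qed

section \<open>Operators representing a form\<close>

lemma inner_product_scale:
  assumes b: "inner_product scale b"
  shows "b (scale a x) y = a * b x y" "b x (scale a y) = a * b x y"
proof -
  have *: "b (scale a x) y = a * b x y" for x y
  proof -
    have "Vector_Spaces.linear scale (*) (\<lambda>x. b x y)"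
      using b by (simp add: inner_product_def)
    then show ?thesis
      by (rule module_hom.scale[OF Vector_Spaces.linear.axioms(3)])
  qed
  show "b (scale a x) y = a * b x y"
    by (rule *)
  show "b x (scale a y) = a * b x y"
    by (simp add: inner_product_sym[OF b, of x] *)
qed

lemma bilinear_eqI:
  assumes b: "\<And>x. Vector_Spaces.linear scale (*) (\<lambda>y. b x y)"
      "\<And>y. Vector_Spaces.linear scale (*) (\<lambda>x. b x y)"
    and d: "\<And>x. Vector_Spaces.linear scale (*) (\<lambda>y. d x y)"
      "\<And>y. Vector_Spaces.linear scale (*) (\<lambda>x. d x y)"
    and S: "basis_of scale UNIV S" and eq: "\<And>u v. u \<in> S \<Longrightarrow> v \<in> S \<Longrightarrow> b u v = d u v"
  shows "b x y = d x y"
proof (rule linear_form_eqI[OF b(2) d(2) S])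
  fix u assume u: "u \<in> S"
  show "b u y = d u y"
    by (rule linear_form_eqI[OF b(1) d(1) S]) (rule eq[OF u])
qed

text \<open>If \<open>F\<close> defines a neighbourhood of \<open>T x\<close>, then \<open>T ` F\<close> defines a neighbourhood of \<open>x\<close> that \<open>T\<close>
  maps into it, because \<open>b (T y) v = b y (T v)\<close>.\<close>

lemma self_adjoint_imp_continuous:
  assumes b: "inner_product scale b" and T: "Vector_Spaces.linear scale scale T"
    and adj: "self_adjoint b T"
  shows "continuous_map (form_topology b) (form_topology b) T"
proof -
  have top: "topspace (form_topology b) = UNIV"
  proof -
    have "openin (form_topology b) UNIV"
      by (auto simp: openin_form_topology[OF b])
    then show ?thesis
      by (metis openin_subset top.extremum_uniqueI)
  qed
  have "openin (form_topology b) {x. T x \<in> U}" if U: "openin (form_topology b) U" for U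
    unfolding openin_form_topology[OF b]
  proof (intro ballI, unfold mem_Collect_eq)
    fix x assume "T x \<in> U"
    then obtain F where F: "finite F" "T x +o (\<Inter>v\<in>F. {y. b y v = 0}) \<subseteq> U"
      using U by (auto simp: openin_form_topology[OF b])
    have "T (x + y) \<in> U" if y: "\<forall>v\<in>F. b y (T v) = 0" for y
    proof -
      have "\<forall>v\<in>F. b (T y) v = 0"
        using y adj by (simp add: self_adjoint_def)
      then have "T x + T y \<in> U"
        using F(2) by (auto simp: elt_set_plus_def)
      then show ?thesis
        using module_hom.add[OF Vector_Spaces.linear.axioms(3)[OF T]] by simp
    qed
    with F(1) show "\<exists>F. finite F \<and> x +o (\<Inter>v\<in>F. {y. b y v = 0}) \<subseteq> {x. T x \<in> U}"
      by (intro exI[of _ "T ` F"]) (auto simp: elt_set_plus_def)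
  qed
  then show ?thesis by (simp add: continuous_map_def top)
qed

text \<open>\<open>T\<close> is the diagonal operator with eigenvalue \<open>b v v / b0 v v\<close> at \<open>v \<in> S\<close>.  The inclusion of the
  radicals makes \<open>b0 (T v) v = b v v\<close> hold for isotropic \<open>v\<close> too.  The last conjunct names the
  eigenbasis \<open>S\<close> so that the operators of a family are seen to be simultaneously diagonalizable.\<close>

lemma representing_operator_exists:
  assumes b0: "inner_product scale b0" and b: "inner_product scale b"
    and rad: "form_radical b0 \<subseteq> form_radical b" and S: "basis_of scale UNIV S"
    and orth0: "\<And>u v. u \<in> S \<Longrightarrow> v \<in> S \<Longrightarrow> u \<noteq> v \<Longrightarrow> b0 u v = 0"
    and orth: "\<And>u v. u \<in> S \<Longrightarrow> v \<in> S \<Longrightarrow> u \<noteq> v \<Longrightarrow> b u v = 0"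
  shows "\<exists>T. Vector_Spaces.linear scale scale T \<and> self_adjoint b0 T \<and>
    continuous_map (form_topology b0) (form_topology b0) T \<and>
    (\<forall>x\<in>form_radical b0. T x = 0) \<and> (\<forall>x y. b x y = b0 (T x) y) \<and>
    (\<forall>v\<in>S. \<exists>c. T v = scale c v)"
proof -
  interpret vp: vector_space_pair scale scale
    by unfold_locales
  \<comment> \<open>Where \<open>b0 v v = 0\<close>, the convention \<open>a / 0 = 0\<close> makes the eigenvalue \<open>0\<close>, which is what
    vanishing on the radical requires.\<close>
  define c where "c v = b v v / b0 v v" for v
  have S': "independent S"
    using S by (simp add: basis_of_def)
  obtain T where T: "Vector_Spaces.linear scale scale T"
    and Tv: "\<And>v. v \<in> S \<Longrightarrow> T v = scale (c v) v"
    using vp.linear_independent_extend[OF S', of "\<lambda>v. scale (c v) v"] by blast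
  note coeff0 = orthogonal_basis_coefficient[OF b0 S orth0]
  have lin: "Vector_Spaces.linear scale (*) (b0 x)" "Vector_Spaces.linear scale (*) (\<lambda>x. b0 x y)"
    "Vector_Spaces.linear scale (*) (b x)" "Vector_Spaces.linear scale (*) (\<lambda>x. b x y)" for x y
    using b0 b by (auto simp: inner_product_def)
  have isotropic: "b v v = 0" if v: "v \<in> S" "b0 v v = 0" for v
  proof -
    have "b0 x v = 0" for x
      using coeff0[of v x] v by simp
    then have "v \<in> form_radical b0"
      by (simp add: form_radical_def inner_product_sym[OF b0, of v])
    with rad show ?thesis by (auto simp: form_radical_def)
  qed
  have rep: "b x y = b0 (T x) y" for x y
  proof (rule bilinear_eqI[OF lin(3,4) _ _ S])
    show "Vector_Spaces.linear scale (*) (b0 (T x))" for x by (rule lin)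
    show "Vector_Spaces.linear scale (*) (\<lambda>x. b0 (T x) y)" for y
      using Vector_Spaces.linear_compose[OF T lin(2)[of y]] by (simp add: o_def)
    fix u v assume uv: "u \<in> S" "v \<in> S"
    have "b0 (T u) v = c u * b0 u v"
      by (simp add: Tv uv inner_product_scale[OF b0])
    then show "b u v = b0 (T u) v"
      using orth[OF uv] orth0[OF uv] isotropic[OF uv(1)] by (cases "u = v") (auto simp: c_def)
  qed
  have adj: "self_adjoint b0 T"
    unfolding self_adjoint_def
    by (metis rep inner_product_sym[OF b0] inner_product_sym[OF b])
  have "T x = 0" if x: "x \<in> form_radical b0" for x
  proof (rule eq_0_if_coefficients_eq_0[OF S])
    fix v assume v: "v \<in> S"
    have "representation S x v * b0 v v = 0"
      using coeff0[of v x] v x by (simp add: form_radical_def)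
    then show "representation S (T x) v = 0"
      by (auto simp: representation_diagonal[OF S T Tv v] c_def)
  qed
  with T adj self_adjoint_imp_continuous[OF b0 T adj] rep Tv show ?thesis
    by blast
qed

lemma representing_operators_exist:
  assumes b0: "inner_product scale b0" and b: "\<And>i. i \<in> J \<Longrightarrow> inner_product scale (B i)"
    and rad: "\<And>i. i \<in> J \<Longrightarrow> form_radical b0 \<subseteq> form_radical (B i)"
    and "simultaneously_orthogonalizable scale (insert b0 (B ` J))"
  shows "\<exists>T. representing_operators scale J B b0 T"
proof -
  obtain S where S: "basis_of scale UNIV S"
    and orth: "\<forall>d\<in>insert b0 (B ` J). \<forall>u\<in>S. \<forall>v\<in>S. u \<noteq> v \<longrightarrow> d u v = 0"
    using assms(4) unfolding simultaneously_orthogonalizable_def by (elim exE conjE)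
  let ?represents = "\<lambda>i T. Vector_Spaces.linear scale scale T \<and> self_adjoint b0 T \<and>
      continuous_map (form_topology b0) (form_topology b0) T \<and>
      (\<forall>x\<in>form_radical b0. T x = 0) \<and> (\<forall>x y. B i x y = b0 (T x) y) \<and>
      (\<forall>v\<in>S. \<exists>c. T v = scale c v)"
  have "\<forall>i\<in>J. \<exists>T. ?represents i T"
  proof
    fix i assume i: "i \<in> J"
    show "\<exists>T. ?represents i T"
      by (rule representing_operator_exists[OF b0 b[OF i] rad[OF i] S]) (use orth i in auto)
  qed
  from bchoice[OF this] obtain T where T: "\<forall>i\<in>J. ?represents i (T i)" ..
  have "simultaneously_diagonalizable scale (T ` J)"
    unfolding simultaneously_diagonalizable_def using S T by (intro exI[of _ S]) auto
  with T have "representing_operators scale J B b0 T"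
    by (simp add: representing_operators_def)
  then show ?thesis
    by (rule exI[of _ T])
qed

section \<open>Root spaces\<close>

text \<open>The component of \<open>v\<close> at \<open>j\<close> must be the part of the basis expansion of \<open>v\<close> that runs over
  \<open>{e \<in> E. r e = j}\<close>: elements of other summands have no coordinates at these \<open>e\<close>.\<close>

lemma internal_direct_sum_of_basis_partition:
  assumes E: "basis_of scale UNIV E" and r: "\<And>v. v \<in> E \<Longrightarrow> r v \<in> A"
    and W: "\<And>j. j \<in> A \<Longrightarrow> W j = span {v \<in> E. r v = j}"
  shows "internal_direct_sum scale A W"
proof -
  have E': "independent E" "\<And>v. v \<in> span E"
    using E by (auto simp: basis_of_def)
  let ?rep = "representation E"
  define g where "g v j = (\<Sum>e | ?rep v e \<noteq> 0 \<and> r e = j. scale (?rep v e) e)" for v j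
  have fin: "finite {e. ?rep v e \<noteq> 0}" for v
    by (rule finite_representation)
  have supp: "{e. ?rep v e \<noteq> 0} \<subseteq> E" for v
    using representation_ne_zero by blast
  have unique: "f = g v"
    if f: "\<forall>j\<in>A. f j \<in> W j" "\<forall>j. j \<notin> A \<longrightarrow> f j = 0" "finite {j. f j \<noteq> 0}"
      "v = (\<Sum>j | f j \<noteq> 0. f j)" for f v
  proof
    fix j
    have own: "r e = k" if ne: "?rep (f k) e \<noteq> 0" for k e
    proof -
      have k: "k \<in> A"
        using ne f(2) by (auto simp: representation_zero)
      then have "?rep (f k) = representation {v \<in> E. r v = k} (f k)"
        using f(1) W by (intro representation_extend[OF E'(1)]) auto
      with ne have "e \<in> {v \<in> E. r v = k}"
        using representation_ne_zero by metis
      then show ?thesis by simp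
    qed
    \<comment> \<open>Only the summand indexed by \<open>r e\<close> contributes to the \<open>e\<close>-coordinate.\<close>
    have total: "?rep v e = ?rep (f (r e)) e" for e
    proof -
      have "?rep v e = (\<Sum>k | f k \<noteq> 0. ?rep (f k) e)"
        unfolding f(4) by (subst representation_sum[OF E'(1)]) (auto simp: E')
      also have "\<dots> = (\<Sum>k | f k \<noteq> 0. if k = r e then ?rep (f k) e else 0)"
        using own by (intro sum.cong refl) auto
      also have "\<dots> = ?rep (f (r e)) e"
        using f(3) by (simp add: representation_zero)
      finally show ?thesis .
    qed
    have "f j = (\<Sum>e | ?rep (f j) e \<noteq> 0. scale (?rep (f j) e) e)"
      using E' by (simp add: sum_nonzero_representation_eq)
    also have "\<dots> = g v j"
      unfolding g_def using own by (intro sum.cong) (auto simp: total)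
    finally show "f j = g v j" .
  qed
  have "g v j \<in> W j" if "j \<in> A" for v j
    unfolding W[OF that] g_def using supp by (intro span_sum span_scale span_base) auto
  moreover have "g v j = 0" if "j \<notin> A" for v j
  proof -
    have "{e. ?rep v e \<noteq> 0 \<and> r e = j} = {}"
      using supp r that by blast
    then show ?thesis
      unfolding g_def by (simp only: sum.empty)
  qed
  moreover have g_supp: "{j. g v j \<noteq> 0} \<subseteq> r ` {e. ?rep v e \<noteq> 0}" for v
  proof
    fix j assume "j \<in> {j. g v j \<noteq> 0}"
    then have "{e. ?rep v e \<noteq> 0 \<and> r e = j} \<noteq> {}"
      unfolding g_def by (auto simp only: sum.empty)
    then show "j \<in> r ` {e. ?rep v e \<noteq> 0}" by blast
  qed
  moreover have "finite {j. g v j \<noteq> 0}" for v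
    using g_supp fin by (meson finite_imageI finite_subset)
  moreover have "v = (\<Sum>j | g v j \<noteq> 0. g v j)" for v
  proof -
    have "v = (\<Sum>e | ?rep v e \<noteq> 0. scale (?rep v e) e)"
      using E' by (simp add: sum_nonzero_representation_eq)
    also have "\<dots> = (\<Sum>j\<in>r ` {e. ?rep v e \<noteq> 0}. g v j)"
      by (subst sum.image_gen[OF fin, of _ _ r]) (simp add: g_def)
    also have "\<dots> = (\<Sum>j | g v j \<noteq> 0. g v j)"
      using fin g_supp by (intro sum.mono_neutral_right) auto
    finally show ?thesis .
  qed
  ultimately have "\<exists>!f. (\<forall>j\<in>A. f j \<in> W j) \<and> (\<forall>j. j \<notin> A \<longrightarrow> f j = 0) \<and> finite {j. f j \<noteq> 0} \<and>
      v = (\<Sum>j | f j \<noteq> 0. f j)" for v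
    by (intro ex1I[of _ "g v"]) (auto intro: unique)
  moreover have "subspace (W j)" if "j \<in> A" for j
    by (simp add: W[OF that])
  ultimately show ?thesis
    by (simp add: internal_direct_sum_def)
qed

text \<open>Applying \<open>T\<close> to a vector \<open>x\<close> of the root space multiplies its \<open>v\<close>-coordinate by \<open>r v T\<close> and also by
  \<open>\<alpha> T\<close>.  So where the coordinate is nonzero, \<open>r v\<close> and \<open>\<alpha>\<close> agree on \<open>\<T>\<close>, hence everywhere, being
  extensional.\<close>

lemma root_space_eq_span:
  assumes E: "basis_of scale UNIV E"
    and lin: "\<And>T. T \<in> \<T> \<Longrightarrow> Vector_Spaces.linear scale scale T"
    and eig: "\<And>v T. v \<in> E \<Longrightarrow> T \<in> \<T> \<Longrightarrow> T v = scale (r v T) v"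
    and r: "\<And>v. v \<in> E \<Longrightarrow> r v \<in> \<T> \<rightarrow>\<^sub>E UNIV" and \<alpha>: "\<alpha> \<in> \<T> \<rightarrow>\<^sub>E UNIV"
  shows "root_space scale \<T> \<alpha> = span {v \<in> E. r v = \<alpha>}"
proof
  have E': "independent E" "\<And>v. v \<in> span E"
    using E by (auto simp: basis_of_def)
  show "root_space scale \<T> \<alpha> \<subseteq> span {v \<in> E. r v = \<alpha>}"
  proof
    fix x assume x: "x \<in> root_space scale \<T> \<alpha>"
    have "r v = \<alpha>" if v: "v \<in> E" "representation E x v \<noteq> 0" for v
    proof (rule PiE_ext[OF r[OF v(1)] \<alpha>])
      fix T assume T: "T \<in> \<T>"
      have "r v T * representation E x v = representation E (T x) v"
        by (rule representation_diagonal[OF E lin[OF T] eig[OF _ T] v(1), symmetric])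
      also have "T x = scale (\<alpha> T) x"
        using x T by (auto simp: root_space_def)
      also have "representation E (scale (\<alpha> T) x) v = \<alpha> T * representation E x v"
        by (simp add: representation_scale E')
      finally show "r v T = \<alpha> T" using v(2) by simp
    qed
    then have "(\<Sum>v | representation E x v \<noteq> 0. scale (representation E x v) v)
        \<in> span {v \<in> E. r v = \<alpha>}"
      using representation_ne_zero by (intro span_sum span_scale span_base) blast
    then show "x \<in> span {v \<in> E. r v = \<alpha>}"
      using E' by (simp add: sum_nonzero_representation_eq)
  qed
next
  have "T w = scale (\<alpha> T) w" if T: "T \<in> \<T>" and w: "w \<in> span {v \<in> E. r v = \<alpha>}" for T w
  proof -
    interpret vp: vector_space_pair scale scale
      by unfold_locales
    show ?thesis
      by (rule vp.linear_eq_on[OF lin[OF T] linear_scale_self w]) (use T eig in auto)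
  qed
  then show "span {v \<in> E. r v = \<alpha>} \<subseteq> root_space scale \<T> \<alpha>"
    by (auto simp: root_space_def)
qed

text \<open>Two roots differ at some \<open>T\<close>, and \<open>\<alpha> T * b x y = b (T x) y = b x (T y) = \<beta> T * b x y\<close>.\<close>

lemma root_spaces_orthogonal:
  assumes b: "inner_product scale b" and adj: "\<And>T. T \<in> \<T> \<Longrightarrow> self_adjoint b T"
  shows "orthogonal_family b (roots scale \<T>) (root_space scale \<T>)"
  unfolding orthogonal_family_def
proof (intro ballI impI)
  fix \<alpha> \<beta> x y
  assume \<alpha>\<beta>: "\<alpha> \<in> roots scale \<T>" "\<beta> \<in> roots scale \<T>" "\<alpha> \<noteq> \<beta>"
    and xy: "x \<in> root_space scale \<T> \<alpha>" "y \<in> root_space scale \<T> \<beta>"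
  then obtain T where T: "T \<in> \<T>" "\<alpha> T \<noteq> \<beta> T"
    unfolding roots_def by (metis (no_types, lifting) PiE_ext mem_Collect_eq)
  have "b (T x) y = b x (T y)"
    using adj[OF T(1)] by (simp add: self_adjoint_def)
  moreover have "T x = scale (\<alpha> T) x" "T y = scale (\<beta> T) y"
    using xy T(1) by (auto simp: root_space_def)
  ultimately have "\<alpha> T * b x y = \<beta> T * b x y"
    by (simp add: inner_product_scale[OF b])
  with T(2) show "b x y = 0" by simp
qed

section \<open>The decomposition\<close>

text \<open>Everything is read off from a basis \<open>E\<close> of common eigenvectors, cut into the parts \<open>S \<alpha>\<close> that
  belong to the roots \<open>\<alpha>\<close>.\<close>

lemma root_space_decomposition:
  assumes b0: "inner_product scale b0" and rep: "representing_operators scale J B b0 T"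
    and R: "R = roots scale (T ` J)" and V: "V = root_space scale (T ` J)"
  shows "internal_direct_sum scale R V"
    and "\<forall>i\<in>J. orthogonal_family (B i) R V"
    and "\<forall>i\<in>J. \<forall>\<alpha>\<in>R. \<forall>x\<in>V \<alpha>. \<forall>y\<in>V \<alpha>. B i x y = \<alpha> (T i) * b0 x y"
    and "\<exists>S. \<forall>i\<in>J. block_diagonal_wrt scale (B i) R V (\<lambda>\<alpha> x y. \<alpha> (T i) * b0 x y) S"
proof -
  let ?\<T> = "T ` J"
  have lin: "Vector_Spaces.linear scale scale U" and adj: "self_adjoint b0 U" if "U \<in> ?\<T>" for U
    using rep that by (auto simp: representing_operators_def)
  have B_T: "B i x y = b0 (T i x) y" if "i \<in> J" for i x y
    using rep that by (simp add: representing_operators_def)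
  obtain E where E: "basis_of scale UNIV E" and diag: "\<forall>v\<in>E. \<forall>U\<in>?\<T>. \<exists>c. U v = scale c v"
    using rep unfolding representing_operators_def simultaneously_diagonalizable_def
    by (elim exE conjE)
  define e where "e v U = (SOME c. U v = scale c v)" for v and U :: "'b \<Rightarrow> 'b"
  have e: "U v = scale (e v U) v" if "v \<in> E" "U \<in> ?\<T>" for v U
    unfolding e_def by (rule someI_ex) (rule diag[rule_format, OF that])
  \<comment> \<open>Roots are extensional, so the eigenvalues of \<open>v\<close> become a root only after restriction.\<close>
  define r where "r v = restrict (e v) ?\<T>" for v
  have r: "r v \<in> ?\<T> \<rightarrow>\<^sub>E UNIV" for v
    by (simp add: r_def)
  have eig: "U v = scale (r v U) v" if "v \<in> E" "U \<in> ?\<T>" for v U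
    unfolding r_def restrict_apply' [OF that(2)] using that by (rule e)
  have E': "independent E" "span E = UNIV"
    using E by (auto simp: basis_of_def)
  have r_root: "r v \<in> R" if v: "v \<in> E" for v
  proof -
    have "v \<noteq> 0"
      using E'(1) v dependent_zero by blast
    with r[of v] eig[OF v] show ?thesis
      unfolding R roots_def by (intro CollectI conjI exI[of _ v]) auto
  qed
  define S where "S \<alpha> = {v \<in> E. r v = \<alpha>}" for \<alpha>
  have V_span: "V \<alpha> = span (S \<alpha>)" if "\<alpha> \<in> R" for \<alpha>
    unfolding V S_def
    by (rule root_space_eq_span[OF E lin eig r]) (use that in \<open>auto simp: R roots_def\<close>)
  have sum: "internal_direct_sum scale R V"
    by (rule internal_direct_sum_of_basis_partition[OF E r_root V_span[unfolded S_def]])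
  have V_I: "T i x = scale (\<alpha> (T i)) x" if "x \<in> V \<alpha>" "i \<in> J" for i x \<alpha>
    using that unfolding V root_space_def by blast
  have scaled: "B i x y = \<alpha> (T i) * b0 x y" if "x \<in> V \<alpha>" "i \<in> J" for i \<alpha> x y
    by (simp add: B_T[OF that(2)] V_I[OF that] inner_product_scale[OF b0])
  have orth0: "orthogonal_family b0 R V"
    unfolding R V by (rule root_spaces_orthogonal[OF b0 adj])
  have orth: "orthogonal_family (B i) R V" if i: "i \<in> J" for i
    using orth0 scaled[OF _ i] by (simp add: orthogonal_family_def)
  have S_basis: "basis_of scale (V \<alpha>) (S \<alpha>)" if "\<alpha> \<in> R" for \<alpha>
    unfolding basis_of_def V_span[OF that]
    using E'(1) dependent_mono[of "S \<alpha>" E] by (auto simp: S_def)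
  have S_Un: "snd ` Sigma R S = E"
    using r_root by (force simp: S_def)
  have block: "block_diagonal_wrt scale (B i) R V (\<lambda>\<alpha> x y. \<alpha> (T i) * b0 x y) S" if i: "i \<in> J" for i
    unfolding block_diagonal_wrt_def S_Un
  proof (intro conjI ballI)
    show "inj_on snd (Sigma R S)"
      by (auto simp: inj_on_def S_def)
    fix p q assume "p \<in> Sigma R S" "q \<in> Sigma R S"
    then obtain \<alpha> v \<beta> w where pq: "p = (\<alpha>, v)" "q = (\<beta>, w)"
      and \<alpha>: "\<alpha> \<in> R" "v \<in> V \<alpha>" and \<beta>: "\<beta> \<in> R" "w \<in> V \<beta>"
      using V_span span_base by fastforce
    have "B i v w = 0" if "\<alpha> \<noteq> \<beta>"
      using orth[OF i] \<alpha> \<beta> that unfolding orthogonal_family_def by blast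
    then show "form_matrix (B i) snd p q =
        block_diagonal (\<lambda>\<alpha>. form_matrix (\<lambda>x y. \<alpha> (T i) * b0 x y) (\<lambda>v. v)) p q"
      using scaled[OF \<alpha>(2) i] by (auto simp: pq form_matrix_def block_diagonal_def)
  qed (use S_basis E in auto)
  show "internal_direct_sum scale R V"
    by (rule sum)
  show "\<forall>i\<in>J. orthogonal_family (B i) R V"
    using orth by blast
  show "\<forall>i\<in>J. \<forall>\<alpha>\<in>R. \<forall>x\<in>V \<alpha>. \<forall>y\<in>V \<alpha>. B i x y = \<alpha> (T i) * b0 x y"
    using scaled by blast
  show "\<exists>S. \<forall>i\<in>J. block_diagonal_wrt scale (B i) R V (\<lambda>\<alpha> x y. \<alpha> (T i) * b0 x y) S"
    using block by blast
qed

end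

theorem corollary4:
  fixes smul :: "'k::field \<Rightarrow> 'v::ab_group_add \<Rightarrow> 'v"
    and I :: "'i set" and i0 :: 'i
    and B :: "'i \<Rightarrow> 'v \<Rightarrow> 'v \<Rightarrow> 'k"
  assumes "vector_space smul"
    and "\<And>i. i \<in> insert i0 I \<Longrightarrow> inner_product smul (B i)"
    and "\<And>i. i \<in> I \<Longrightarrow> form_radical (B i0) \<subseteq> form_radical (B i)"
    and "\<And>i. i \<in> insert i0 I \<Longrightarrow>
           partially_continuous (form_topology (B i0)) (discrete_topology UNIV) (B i)"
    and "simultaneously_orthogonalizable smul (B ` insert i0 I)"
  shows "(\<exists>T. representing_operators smul (insert i0 I) B (B i0) T) \<and>
    (\<forall>T. representing_operators smul (insert i0 I) B (B i0) T \<longrightarrow>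
      (let R = roots smul (T ` insert i0 I);
           V = root_space smul (T ` insert i0 I)
       in internal_direct_sum smul R V \<and>
          (\<forall>i\<in>insert i0 I. orthogonal_family (B i) R V) \<and>
          (\<exists>c. (\<forall>i\<in>insert i0 I. \<forall>\<alpha>\<in>R. \<forall>x\<in>V \<alpha>. \<forall>y\<in>V \<alpha>. B i x y = c i \<alpha> * B i0 x y) \<and>
               (\<exists>S. \<forall>i\<in>insert i0 I.
                  block_diagonal_wrt smul (B i) R V (\<lambda>\<alpha> x y. c i \<alpha> * B i0 x y) S))))"
proof -
  interpret vector_space smul by fact
  let ?J = "insert i0 I"
  have B0: "inner_product smul (B i0)"
    using assms(2) by simp
  have "B ` ?J = insert (B i0) (B ` ?J)"
    by auto
  then have "simultaneously_orthogonalizable smul (insert (B i0) (B ` ?J))"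
    using assms(5) by simp
  then have exists: "\<exists>T. representing_operators smul ?J B (B i0) T"
    using assms(3) by (intro representing_operators_exist[OF B0 assms(2)]) auto
  show ?thesis
    unfolding Let_def
  proof (intro conjI allI impI exists)
    fix T assume T: "representing_operators smul ?J B (B i0) T"
    note decomposition = root_space_decomposition[OF B0 T refl refl]
    let ?R = "roots smul (T ` ?J)" and ?V = "root_space smul (T ` ?J)"
    show "internal_direct_sum smul ?R ?V"
      by (rule decomposition(1))
    show "\<forall>i\<in>?J. orthogonal_family (B i) ?R ?V"
      by (rule decomposition(2))
    show "\<exists>c. (\<forall>i\<in>?J. \<forall>\<alpha>\<in>?R. \<forall>x\<in>?V \<alpha>. \<forall>y\<in>?V \<alpha>. B i x y = c i \<alpha> * B i0 x y) \<and>
        (\<exists>S. \<forall>i\<in>?J. block_diagonal_wrt smul (B i) ?R ?V (\<lambda>\<alpha> x y. c i \<alpha> * B i0 x y) S)"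
      by (rule exI[of _ "\<lambda>i \<alpha>. \<alpha> (T i)"]) (rule conjI[OF decomposition(3,4)])
  qed
qed

end
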